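(* Let $0<\alpha<1$, let $n\ge3$ be an integer, let $j$ be even, $1\le j\le n$, and let $y_{\alpha,n,j}^{(0)}\in\left[\frac{(j-1)\pi}{n},\frac{j\pi}{n}\right]$. Define the sequence $(y_{\alpha,n,j}^{(m)})_{m=0}^\infty$ by the recursive formula $$y_{\alpha,n,j}^{(m)}=y_{\alpha,n,j}^{(m-1)}-\frac{h_{\alpha,n,j}\left(y_{\alpha,n,j}^{(m-1)}\right)}{h_{\alpha,n,j}'\left(y_{\alpha,n,j}^{(m-1)}\right)}\qquad(m\ge1).$$ Then $(y_{\alpha,n,j}^{(m)})_{m=0}^\infty$ converges to $\vartheta_{\alpha,n,j}$. If $n>\sqrt{\pi\mathcal{K}_2(\alpha)/2}$, then for every $m\ge 0$ $$\left|y_{\alpha,n,j}^{(m)}-\vartheta_{\alpha,n,j}\right|\le\frac{\pi}{n}\left(\frac{\pi\mathcal{K}_2(\alpha)}{2n^2}\right)^{2^m-1}.$$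
   Context: For an integer $n\ge3$ and a real number $\alpha$, $L_{\alpha,n}$ is the real symmetric $n\times n$ matrix with entries: $(L_{\alpha,n})_{1,1}=(L_{\alpha,n})_{n,n}=1+\alpha$; $(L_{\alpha,n})_{k,k}=2$ for $2\le k\le n-1$; $(L_{\alpha,n})_{k,k+1}=(L_{\alpha,n})_{k+1,k}=-1$ for $1\le k\le n-1$; $(L_{\alpha,n})_{1,n}=(L_{\alpha,n})_{n,1}=-\alpha$; all other entries are $0$. Its eigenvalues, counted with multiplicity, are $\lambda_{\alpha,n,1}\le\dots\le\lambda_{\alpha,n,n}$; for $0<\alpha<1$ they belong to $[0,4]$. Let $g(x)=2-2\cos x$, a bijection of $[0,\pi]$ onto $[0,4]$; $\vartheta_{\alpha,n,j}$ is the unique number in $[0,\pi]$ with $g(\vartheta_{\alpha,n,j})=\lambda_{\alpha,n,j}$. Put $\varkappa_\alpha=\frac{\alpha}{1-\alpha}$, and let $\eta_\alpha(x)=2\arctan\left(\varkappa_\alpha\cot\frac{x}{2}\right)$ for $0<x\le\pi$. For $n\ge 3$ and $j$ even, $1\le j\le n$, the function $h_{\alpha,n,j}\colon\left[\frac{(j-1)\pi}{n},\frac{j\pi}{n}\right]\to\mathbb{R}$ is $h_{\alpha,n,j}(x)=nx-(j-1)\pi-\eta_\alpha(x)$ (derivatives at endpoints are one-sided). Further, $\mathcal{K}_1(\alpha)=\max\{\varkappa_\alpha,1/\varkappa_\alpha\}$ and $\mathcal{K}_2(\alpha)=\frac{|\varkappa_\alpha^2-1|}{2\varkappa_\alpha}\mathcal{K}_1(\alpha)=\frac{\mathcal{K}_1(\alpha)^2-1}{2}$.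 *)

theory Defs
  imports
    "HOL-Analysis.Analysis"
    "Jordan_Normal_Form.Char_Poly"
begin

text \<open>Row and column indices of matrices start at \<open>0\<close>, so index \<open>i\<close> below stands for the
  mathematical index \<open>i + 1\<close>.\<close>

definition L_mat :: "real \<Rightarrow> nat \<Rightarrow> real Matrix.mat" where
  "L_mat \<alpha> n = Matrix.mat n n (\<lambda>(i, k).
     if i = k then (if i = 0 \<or> i = n - 1 then 1 + \<alpha> else 2)
     else if k = i + 1 \<or> i = k + 1 then -1
     else if (i = 0 \<and> k = n - 1) \<or> (i = n - 1 \<and> k = 0) then -\<alpha>
     else 0)"

text \<open>\<open>eig \<alpha> n j\<close> is the \<open>j\<close>-th smallest eigenvalue (\<open>1 \<le> j \<le> n\<close>), repeated according to its
  multiplicity as a root of the characteristic polynomial. This is the geometric multiplicity as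
  well, since the matrix is real symmetric.\<close>

definition eig :: "real \<Rightarrow> nat \<Rightarrow> nat \<Rightarrow> real" where
  "eig \<alpha> n j = sorted_list_of_multiset (proots (char_poly (L_mat \<alpha> n))) ! (j - 1)"

definition g :: "real \<Rightarrow> real" where
  "g x = 2 - 2 * cos x"

definition theta :: "real \<Rightarrow> nat \<Rightarrow> nat \<Rightarrow> real" where
  "theta \<alpha> n j = (THE t. t \<in> {0..pi} \<and> g t = eig \<alpha> n j)"

definition kappa :: "real \<Rightarrow> real" where
  "kappa \<alpha> = \<alpha> / (1 - \<alpha>)"

definition eta :: "real \<Rightarrow> real \<Rightarrow> real" where
  "eta \<alpha> x = 2 * arctan (kappa \<alpha> * cot (x / 2))"

definition Ivl :: "nat \<Rightarrow> nat \<Rightarrow> real set" where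
  "Ivl n j = {(real j - 1) * pi / real n .. real j * pi / real n}"

text \<open>Only the values of \<open>h \<alpha> n j\<close> on \<open>Ivl n j\<close> are meaningful. Its derivative is taken within
  that interval, hence is one-sided at the endpoints.\<close>

definition h :: "real \<Rightarrow> nat \<Rightarrow> nat \<Rightarrow> real \<Rightarrow> real" where
  "h \<alpha> n j x = real n * x - (real j - 1) * pi - eta \<alpha> x"

definition h' :: "real \<Rightarrow> nat \<Rightarrow> nat \<Rightarrow> real \<Rightarrow> real" where
  "h' \<alpha> n j x = vector_derivative (h \<alpha> n j) (at x within Ivl n j)"

definition K1 :: "real \<Rightarrow> real" where
  "K1 \<alpha> = max (kappa \<alpha>) (1 / kappa \<alpha>)"

definition K2 :: "real \<Rightarrow> real" where
  "K2 \<alpha> = \<bar>(kappa \<alpha>)\<^sup>2 - 1\<bar> / (2 * kappa \<alpha>) * K1 \<alpha>"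

lemma K2_alt:
  assumes "0 < \<alpha>" "\<alpha> < 1"
  shows "K2 \<alpha> = ((K1 \<alpha>)\<^sup>2 - 1) / 2"
proof -
  define k where "k = kappa \<alpha>"
  have k: "k > 0"
    using assms by (simp add: k_def kappa_def)
  show ?thesis
  proof (cases "k \<ge> 1")
    case True
    have "1 / k \<le> 1"
      using True by simp
    then have K1: "K1 \<alpha> = k"
      using True unfolding K1_def k_def[symmetric] by linarith
    have "k\<^sup>2 \<ge> 1"
      using True by simp
    then show ?thesis
      using k by (simp add: K2_def K1 flip: k_def)
  next
    case False
    then have "1 / k \<ge> 1"
      using k by simp
    then have K1: "K1 \<alpha> = 1 / k"
      using False unfolding K1_def k_def[symmetric] by linarith
    have "k\<^sup>2 \<le> 1"
      using False k by (simp add: power_le_one)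
    then show ?thesis
      using k by (simp add: K2_def K1 power2_eq_square field_simps flip: k_def)
  qed
qed

end

theory Submission
  imports Defs
begin

text \<open>For \<open>\<lambda> = g x\<close> the eigenvalue equations of \<open>L_mat \<alpha> n\<close> are solved by sequences
  \<open>cos (k x + b)\<close> that are symmetric or antisymmetric about the middle index. The symmetric ones
  force \<open>x = (j - 1) \<pi> / n\<close> with \<open>j\<close> odd, the antisymmetric ones lead to \<open>h \<alpha> n j x = 0\<close> with
  \<open>j\<close> even. The resulting \<open>n\<close> values of \<open>x\<close> lie one in each interval
  \<open>[(j - 1) \<pi> / n, j \<pi> / n)\<close>, so they yield all the eigenvalues, in increasing order.

  Since \<open>h' \<ge> n\<close> and \<open>0 \<le> eta \<alpha> x \<le> \<pi>\<close>, a Newton step never leaves \<open>Ivl n j\<close>. As \<open>h'\<close> is monotone,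
  all iterates but the first lie on one side of the zero, and there the error is multiplied
  by \<open>1 - h' \<xi> / h' (y m)\<close>, which lies in \<open>[0, q]\<close> for a fixed \<open>q < 1\<close>. The quadratic bound is
  Taylor's formula together with \<open>\<bar>h''\<bar> \<le> K2 \<alpha>\<close>.\<close>

subsection \<open>Eigenvalues\<close>

text \<open>No row has more than three nonzero entries, and \<open>n \<ge> 3\<close> keeps their
  column indices distinct, so each row sum collapses to three terms.\<close>

lemma L_mat_row_sum:
  fixes w :: "nat \<Rightarrow> real"
  assumes n: "n \<ge> 3" and i: "i < n"
  shows "(\<Sum>k<n. L_mat \<alpha> n $$ (i, k) * w k) =
    (if i = 0 then (1 + \<alpha>) * w 0 - w 1 - \<alpha> * w (n - 1)
     else if i = n - 1 then (1 + \<alpha>) * w (n - 1) - w (n - 2) - \<alpha> * w 0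
     else 2 * w i - w (i - 1) - w (i + 1))"
proof -
  have restrict: "(\<Sum>k<n. L_mat \<alpha> n $$ (i, k) * w k) = (\<Sum>k\<in>S. L_mat \<alpha> n $$ (i, k) * w k)"
    if "S \<subseteq> {..<n}" "\<And>k. k < n \<Longrightarrow> k \<notin> S \<Longrightarrow> L_mat \<alpha> n $$ (i, k) = 0" for S
    by (rule sum.mono_neutral_right) (use that in auto)
  consider "i = 0" | "i = n - 1" "i \<noteq> 0" | "0 < i" "i < n - 1"
    using i by linarith
  then show ?thesis
  proof cases
    case 1
    have "(\<Sum>k<n. L_mat \<alpha> n $$ (i, k) * w k) = (\<Sum>k\<in>{0, 1, n - 1}. L_mat \<alpha> n $$ (i, k) * w k)"
      by (rule restrict) (use n 1 in \<open>auto simp: L_mat_def\<close>)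
    also have "\<dots> = (1 + \<alpha>) * w 0 - w 1 - \<alpha> * w (n - 1)"
      using n 1 by (auto simp: L_mat_def)
    finally show ?thesis
      using 1 by simp
  next
    case 2
    have "(\<Sum>k<n. L_mat \<alpha> n $$ (i, k) * w k) =
        (\<Sum>k\<in>{0, n - 2, n - 1}. L_mat \<alpha> n $$ (i, k) * w k)"
      by (rule restrict) (use n 2 in \<open>auto simp: L_mat_def\<close>)
    also have "\<dots> = (1 + \<alpha>) * w (n - 1) - w (n - 2) - \<alpha> * w 0"
      using n 2 by (auto simp: L_mat_def)
    finally show ?thesis
      using 2 n by simp
  next
    case 3
    then obtain m where m: "i = Suc m"
      by (auto simp: gr0_conv_Suc)
    have "(\<Sum>k<n. L_mat \<alpha> n $$ (i, k) * w k) =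
        (\<Sum>k\<in>{m, Suc m, Suc (Suc m)}. L_mat \<alpha> n $$ (i, k) * w k)"
      by (rule restrict) (use n 3 m in \<open>auto simp: L_mat_def\<close>)
    also have "\<dots> = 2 * w i - w (i - 1) - w (i + 1)"
      using n 3 m by (auto simp: L_mat_def)
    finally show ?thesis
      using 3 by simp
  qed
qed

text \<open>A sequence \<open>cos (k x + b)\<close> satisfies the interior equations with eigenvalue \<open>g x\<close>.
  Extending it to the indices \<open>-1\<close> and \<open>n\<close>, the first and the last equation become
  the two boundary conditions below.\<close>

lemma char_poly_root_cos:
  fixes x b :: real
  assumes n: "n \<ge> 3"
    and first: "cos (b - x) = (1 - \<alpha>) * cos b + \<alpha> * cos ((real n - 1) * x + b)"
    and last: "cos (real n * x + b) = (1 - \<alpha>) * cos ((real n - 1) * x + b) + \<alpha> * cos b"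
    and nz: "sin x \<noteq> 0 \<or> cos b \<noteq> 0"
  shows "poly (char_poly (L_mat \<alpha> n)) (g x) = 0"
proof -
  define w where "w k = cos (real k * x + b)" for k :: nat
  define v where "v = Matrix.vec n w"
  have L: "L_mat \<alpha> n \<in> carrier_mat n n"
    by (simp add: L_mat_def)
  have rec: "2 * cos t - cos (t - x) - cos (t + x) = g x * cos t" for t
    by (simp add: g_def cos_add cos_diff algebra_simps)
  have row: "(\<Sum>k<n. L_mat \<alpha> n $$ (i, k) * w k) = g x * w i" if i: "i < n" for i
  proof -
    consider "i = 0" | "i = n - 1" "i \<noteq> 0" | "0 < i" "i < n - 1"
      using i by linarith
    then show ?thesis
    proof cases
      case 1
      have "real (n - 1) = real n - 1"
        using n by simp
      then show ?thesis
        using L_mat_row_sum[OF n i, of \<alpha> w] first rec[of b] 1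
        by (simp add: w_def algebra_simps)
    next
      case 2
      have eqs: "real (n - 1) * x + b = (real n - 1) * x + b"
        "real (n - 2) * x + b = (real n - 1) * x + b - x"
        "(real n - 1) * x + b + x = real n * x + b"
        using n by (simp_all add: algebra_simps)
      show ?thesis
        using L_mat_row_sum[OF n i, of \<alpha> w] last rec[of "(real n - 1) * x + b"] 2 n
        unfolding w_def eqs by (simp add: eqs) (simp add: algebra_simps)
    next
      case 3
      have eqs: "real (i - 1) * x + b = real i * x + b - x"
        "real (i + 1) * x + b = real i * x + b + x"
        using 3 by (simp_all add: algebra_simps)
      show ?thesis
        using L_mat_row_sum[OF n i, of \<alpha> w] rec[of "real i * x + b"] 3
        unfolding w_def eqs by simp
    qed
  qed
  have "L_mat \<alpha> n *\<^sub>v v = g x \<cdot>\<^sub>v v"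
  proof (rule eq_vecI)
    fix i assume "i < dim_vec (g x \<cdot>\<^sub>v v)"
    then have i: "i < n"
      by (simp add: v_def)
    have "(L_mat \<alpha> n *\<^sub>v v) $ i = (\<Sum>k<n. L_mat \<alpha> n $$ (i, k) * w k)"
      using i L by (simp add: v_def scalar_prod_def lessThan_atLeast0)
    then show "(L_mat \<alpha> n *\<^sub>v v) $ i = (g x \<cdot>\<^sub>v v) $ i"
      using row[OF i] i by (simp add: v_def)
  qed (use L in \<open>simp add: v_def\<close>)
  \<comment> \<open>The first two entries decide this: both vanish only if cos b = 0 and sin x sin b
    = 0, which \<open>nz\<close> excludes because sin b and cos b have no common zero.\<close>
  moreover have "v \<noteq> 0\<^sub>v n"
  proof
    assume "v = 0\<^sub>v n"
    then have "v $ 0 = 0" "v $ 1 = 0"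
      using n by simp_all
    then have c: "cos b = 0" "cos (x + b) = 0"
      using n by (simp_all add: v_def w_def)
    then have "sin x * sin b = 0"
      by (simp add: cos_add)
    with nz c show False
      using sin_cos_squared_add[of b] by auto
  qed
  ultimately have "eigenvector (L_mat \<alpha> n) v (g x)"
    using L by (simp add: eigenvector_def v_def)
  then show ?thesis
    using eigenvalue_root_char_poly[OF L] unfolding eigenvalue_def by blast
qed

text \<open>The phase \<open>b\<close> centres the sequence at (n - 1)/2. As cosine is even, both
  boundary conditions become cos(c + x/2) = cos(c - x/2), that is, sin c sin(x/2) = 0. For
  \<open>x = 0\<close> the eigenvector is constant.\<close>

lemma char_poly_root_symmetric:
  assumes n: "n \<ge> 3" and sin0: "sin (real n * x / 2) = 0" and x: "0 \<le> x" "x < pi"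
  shows "poly (char_poly (L_mat \<alpha> n)) (g x) = 0"
proof -
  define b c where "b = - (real n - 1) * x / 2" and "c = real n * x / 2"
  have args: "b - x = - (c + x / 2)" "b = - (c - x / 2)"
    "(real n - 1) * x + b = c - x / 2" "real n * x + b = c + x / 2"
    by (simp_all add: b_def c_def field_simps)
  have cos_args: "cos (b - x) = cos (c + x / 2)" "cos b = cos (c - x / 2)"
    "cos ((real n - 1) * x + b) = cos (c - x / 2)" "cos (real n * x + b) = cos (c + x / 2)"
    using args by (metis cos_minus)+
  have "cos (c + x / 2) = cos (c - x / 2)"
    using sin0 by (simp add: c_def cos_add cos_diff)
  then have "cos (b - x) = (1 - \<alpha>) * cos b + \<alpha> * cos ((real n - 1) * x + b)"
    and "cos (real n * x + b) = (1 - \<alpha>) * cos ((real n - 1) * x + b) + \<alpha> * cos b"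
    unfolding cos_args by (simp_all add: algebra_simps)
  moreover have "sin x \<noteq> 0 \<or> cos b \<noteq> 0"
  proof (cases "x = 0")
    case False
    then show ?thesis
      using sin_gt_zero[of x] x by simp
  qed (simp add: b_def)
  ultimately show ?thesis
    by (rule char_poly_root_cos[OF n])
qed

text \<open>Shifting the centred phase by -pi/2 turns cosines into sines, so the sequence is odd
  about its centre. Both boundary conditions become sin(c + x/2) = (1 - 2 \<alpha>) sin(c - x/2), of
  which \<open>char\<close> is the expanded form.\<close>

lemma char_poly_root_antisymmetric:
  assumes n: "n \<ge> 3" and x: "0 < x" "x < pi"
    and char: "\<alpha> * (sin (real n * x / 2) * cos (x / 2)) =
      (\<alpha> - 1) * (cos (real n * x / 2) * sin (x / 2))"
  shows "poly (char_poly (L_mat \<alpha> n)) (g x) = 0"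
proof -
  define b c where "b = - (real n - 1) * x / 2 - pi / 2" and "c = real n * x / 2"
  have args: "b - x = - (c + x / 2) - pi / 2" "b = - (c - x / 2) - pi / 2"
    "(real n - 1) * x + b = c - x / 2 - pi / 2" "real n * x + b = c + x / 2 - pi / 2"
    by (simp_all add: b_def c_def field_simps)
  have shift: "cos (t - pi / 2) = sin t" for t :: real
    by (simp add: cos_diff)
  have cos_args: "cos (b - x) = - sin (c + x / 2)" "cos b = - sin (c - x / 2)"
    "cos ((real n - 1) * x + b) = sin (c - x / 2)" "cos (real n * x + b) = sin (c + x / 2)"
    using args by (metis shift sin_minus)+
  have char': "sin (c + x / 2) = (1 - 2 * \<alpha>) * sin (c - x / 2)"
    using char by (simp add: c_def sin_add sin_diff algebra_simps)
  have "cos (b - x) = (1 - \<alpha>) * cos b + \<alpha> * cos ((real n - 1) * x + b)"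
    and "cos (real n * x + b) = (1 - \<alpha>) * cos ((real n - 1) * x + b) + \<alpha> * cos b"
    unfolding cos_args char' by (simp_all add: algebra_simps)
  moreover have "sin x \<noteq> 0 \<or> cos b \<noteq> 0"
    using sin_gt_zero[of x] x by simp
  ultimately show ?thesis
    by (rule char_poly_root_cos[OF n])
qed

text \<open>With j = 2m, a zero of \<open>h\<close> says that nx/2 = m pi + t - pi/2, where tan t =
  \<open>kappa \<alpha> * cot (x / 2)\<close>. In sines and cosines with denominators cleared, this
  is the equation of the antisymmetric eigenvectors.\<close>

lemma char_poly_root_h_zero:
  assumes \<alpha>: "0 < \<alpha>" "\<alpha> < 1" and n: "n \<ge> 3" and j: "even j"
    and x: "0 < x" "x < pi" and zero: "h \<alpha> n j x = 0"
  shows "poly (char_poly (L_mat \<alpha> n)) (g x) = 0"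
proof (rule char_poly_root_antisymmetric[OF n x])
  define t where "t = arctan (kappa \<alpha> * cot (x / 2))"
  obtain m where m: "j = 2 * m"
    using j by blast
  have s: "sin (x / 2) > 0"
    using x by (intro sin_gt_zero) auto
  have nx: "real n * x / 2 = real m * pi + t - pi / 2"
    using zero by (simp add: h_def eta_def t_def m field_simps)
  have ct: "cos t > 0"
    unfolding t_def by (intro cos_gt_zero_pi arctan_lbound arctan_ubound)
  have "sin t / cos t = kappa \<alpha> * cot (x / 2)"
    using tan_arctan[of "kappa \<alpha> * cot (x / 2)"] by (simp only: t_def tan_def)
  then have tan: "(1 - \<alpha>) * (sin t * sin (x / 2)) = \<alpha> * (cos t * cos (x / 2))"
    using s ct \<alpha> by (simp add: kappa_def cot_def field_simps)
  have sin_nx: "sin (real n * x / 2) = - (cos (real m * pi) * cos t)"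
    and cos_nx: "cos (real n * x / 2) = cos (real m * pi) * sin t"
    unfolding nx by (simp_all add: sin_diff cos_diff sin_add cos_add)
  have "\<alpha> * (sin (real n * x / 2) * cos (x / 2)) =
      - cos (real m * pi) * (\<alpha> * (cos t * cos (x / 2)))"
    unfolding sin_nx by simp
  also have "\<dots> = - cos (real m * pi) * ((1 - \<alpha>) * (sin t * sin (x / 2)))"
    by (simp only: tan)
  also have "\<dots> = (\<alpha> - 1) * (cos (real n * x / 2) * sin (x / 2))"
    unfolding cos_nx by (simp add: algebra_simps)
  finally show "\<alpha> * (sin (real n * x / 2) * cos (x / 2)) =
      (\<alpha> - 1) * (cos (real n * x / 2) * sin (x / 2))" .
qed

section \<open>Sorting the spectrum\<close>

lemma g_strict_mono:
  assumes "0 \<le> x" "x < y" "y \<le> pi"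
  shows "g x < g y"
  using cos_monotone_0_pi[of x y] assms by (simp add: g_def)

text \<open>A polynomial of degree \<open>n\<close> has at most \<open>n\<close> roots with
  multiplicity, so \<open>n\<close> distinct ones exhaust \<open>proots\<close>; listed
  increasingly, they already form the sorted list.\<close>

lemma eig_eqI:
  fixes t :: "nat \<Rightarrow> real"
  assumes root: "\<And>i. i < n \<Longrightarrow> poly (char_poly (L_mat \<alpha> n)) (t i) = 0"
    and less: "\<And>i. Suc i < n \<Longrightarrow> t i < t (Suc i)"
    and j: "1 \<le> j" "j \<le> n"
  shows "eig \<alpha> n j = t (j - 1)"
proof -
  define p where "p = char_poly (L_mat \<alpha> n)"
  have L: "L_mat \<alpha> n \<in> carrier_mat n n"
    by (simp add: L_mat_def)
  have deg: "degree p = n" and "coeff p n = 1"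
    using degree_monic_char_poly[OF L] by (simp_all add: p_def)
  then have p0: "p \<noteq> 0"
    by auto
  define xs where "xs = map t [0..<n]"
  have "sorted_wrt (<) xs"
    by (subst sorted_wrt_iff_nth_Suc_transp) (use less in \<open>auto simp: xs_def intro: transpI\<close>)
  then have xs: "sorted xs" "distinct xs"
    by (simp_all add: strict_sorted_iff)
  have "mset xs = mset_set (set xs)"
    using xs by (simp add: mset_set_set)
  also have "\<dots> \<subseteq># mset_set (set_mset (proots p))"
    using root p0 by (intro subset_imp_msubset_mset_set) (auto simp: xs_def p_def poly_roots_finite)
  also have "\<dots> \<subseteq># proots p"
    by (rule mset_set_set_mset_msubset)
  finally have sub: "mset xs \<subseteq># proots p" .
  have "size (proots p) \<le> size (mset xs)"
    using size_proots_le[of p] by (simp add: xs_def deg)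
  with sub have "proots p = mset xs"
    using mset_subset_size by (metis leD subset_mset.le_neq_trans)
  then have "sorted_list_of_multiset (proots p) = xs"
    using xs by (simp add: sorted_sort_id)
  then show ?thesis
    using j by (simp add: eig_def xs_def flip: p_def)
qed

subsection \<open>Newton's method\<close>

lemma newton_tendsto:
  fixes F F' :: "real \<Rightarrow> real" and y :: "nat \<Rightarrow> real"
  assumes deriv: "\<And>x. x \<in> {a..b} \<Longrightarrow> (F has_real_derivative F' x) (at x)"
    and bounds: "\<And>x. x \<in> {a..b} \<Longrightarrow> c \<le> F' x" "\<And>x. x \<in> {a..b} \<Longrightarrow> F' x \<le> C" and c: "0 < c"
    and mono: "mono_on {a..b} F' \<or> antimono_on {a..b} F'"
    and y: "\<And>m. y m \<in> {a..b}" "\<And>m. y (Suc m) = y m - F (y m) / F' (y m)"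
    and z: "z \<in> {a..b}" "F z = 0"
  shows "y \<longlonglongrightarrow> z"
proof -
  have mvt: "\<exists>\<xi>\<in>{a..b}. F x = (x - z) * F' \<xi> \<and> (x \<le> \<xi> \<and> \<xi> \<le> z \<or> z \<le> \<xi> \<and> \<xi> \<le> x)"
    if x: "x \<in> {a..b}" for x
  proof -
    consider "x < z" | "x = z" | "z < x"
      by linarith
    then show ?thesis
    proof cases
      case 1
      then obtain \<xi> where "x < \<xi>" "\<xi> < z" "F z - F x = (z - x) * F' \<xi>"
        using MVT2[of x z F F'] deriv x z by force
      then show ?thesis
        using x z by (intro bexI[of _ \<xi>]) (auto simp: algebra_simps)
    next
      case 2
      then show ?thesis
        using z by auto
    next
      case 3
      then obtain \<xi> where "z < \<xi>" "\<xi> < x" "F x - F z = (x - z) * F' \<xi>"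
        using MVT2[of z x F F'] deriv x z by force
      then show ?thesis
        using x z by (intro bexI[of _ \<xi>]) auto
    qed
  qed
  have C: "C > 0" "c \<le> C"
    using bounds[OF z(1)] c by linarith+
  \<comment> \<open>The sign \<open>s\<close> makes \<open>s * F'\<close> nondecreasing in both
    cases; \<open>e m \<ge> 0\<close> then describes the side of \<open>z\<close> on which the
    iterates settle.\<close>
  define s :: real where "s = (if mono_on {a..b} F' then 1 else -1)"
  have s: "s * F' u \<le> s * F' v" if "u \<in> {a..b}" "v \<in> {a..b}" "u \<le> v" for u v
    using mono that unfolding s_def monotone_on_def by auto
  have s_cases: "s = 1 \<or> s = -1"
    by (simp add: s_def)
  define e where "e m = s * (y m - z)" for m
  \<comment> \<open>By the mean value theorem the error is multiplied by 1 - r with r =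
    \<open>F' \<xi> / F' (y m)\<close>. The side of \<open>z\<close> on which \<open>y m\<close>
    lies decides whether r is at most or at least 1.\<close>
  have step: "\<exists>r. e (Suc m) = e m * (1 - r) \<and> c / C \<le> r \<and> (e m \<ge> 0 \<longrightarrow> r \<le> 1) \<and> (e m < 0 \<longrightarrow> 1 \<le> r)"
    for m
  proof -
    obtain \<xi> where \<xi>: "\<xi> \<in> {a..b}" "F (y m) = (y m - z) * F' \<xi>"
      "y m \<le> \<xi> \<and> \<xi> \<le> z \<or> z \<le> \<xi> \<and> \<xi> \<le> y m"
      using mvt[OF y(1)[of m]] by blast
    have pos: "F' (y m) > 0" "F' \<xi> > 0"
      using bounds(1)[OF y(1)[of m]] bounds(1)[OF \<xi>(1)] c by linarith+
    define r where "r = F' \<xi> / F' (y m)"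
    have "y (Suc m) - z = (y m - z) * (1 - r)"
      using y(2)[of m] \<xi>(2) pos by (simp add: r_def field_simps)
    then have "e (Suc m) = e m * (1 - r)"
      by (simp add: e_def)
    moreover have "c / C \<le> r"
      unfolding r_def using bounds(1)[OF \<xi>(1)] bounds(2)[OF y(1)[of m]] c pos by (intro frac_le) auto
    moreover have "r \<le> 1" if "e m \<ge> 0"
    proof -
      have "F' \<xi> \<le> F' (y m)"
        using that s_cases \<xi>(1,3) s[OF \<xi>(1) y(1)[of m]] s[OF y(1)[of m] \<xi>(1)]
        by (auto simp: e_def)
      then show ?thesis
        using pos by (simp add: r_def)
    qed
    moreover have "1 \<le> r" if "e m < 0"
    proof -
      have "F' (y m) \<le> F' \<xi>"
        using that s_cases \<xi>(1,3) s[OF \<xi>(1) y(1)[of m]] s[OF y(1)[of m] \<xi>(1)]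
        by (auto simp: e_def)
      then show ?thesis
        using pos by (simp add: r_def)
    qed
    ultimately show ?thesis
      by blast
  qed
  have nonneg: "e (Suc m) \<ge> 0" for m
  proof -
    obtain r where "e (Suc m) = e m * (1 - r)" "e m \<ge> 0 \<longrightarrow> r \<le> 1" "e m < 0 \<longrightarrow> 1 \<le> r"
      using step by blast
    then show ?thesis
      by (cases "e m \<ge> 0") (auto intro: mult_nonneg_nonneg mult_nonpos_nonpos)
  qed
  define q where "q = 1 - c / C"
  have q: "0 \<le> q" "q < 1"
    using C c by (auto simp: q_def)
  have contract: "e (Suc (Suc m)) \<le> q * e (Suc m)" for m
  proof -
    obtain r where "e (Suc (Suc m)) = e (Suc m) * (1 - r)" "c / C \<le> r"
      using step by blast
    then show ?thesis
      using mult_left_mono[OF _ nonneg[of m], of "1 - r" q] by (simp add: q_def mult.commute)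
  qed
  \<comment> \<open>The geometric decay is counted from index 1, since \<open>e 0\<close> may be
    negative.\<close>
  have geom: "e (Suc m) \<le> q ^ m * e (Suc 0)" for m
  proof (induction m)
    case (Suc m)
    have "e (Suc (Suc m)) \<le> q * e (Suc m)"
      by (rule contract)
    also have "\<dots> \<le> q * (q ^ m * e (Suc 0))"
      using Suc q by (intro mult_left_mono) auto
    finally show ?case
      by (simp add: mult.assoc)
  qed simp
  have lim: "(\<lambda>m. q ^ m * e (Suc 0)) \<longlonglongrightarrow> 0"
    using q by (intro tendsto_mult_left_zero LIMSEQ_realpow_zero)
  have "(\<lambda>m. e (Suc m)) \<longlonglongrightarrow> 0"
    by (rule real_tendsto_sandwich[where f = "\<lambda>_. 0" and h = "\<lambda>m. q ^ m * e (Suc 0)"])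
      (use nonneg geom lim in auto)
  then have "e \<longlonglongrightarrow> 0"
    by (rule LIMSEQ_imp_Suc)
  then have "(\<lambda>m. s * e m + z) \<longlonglongrightarrow> s * 0 + z"
    by (intro tendsto_intros)
  moreover have "s * e m + z = y m" for m
    using s_cases by (auto simp: e_def)
  ultimately show ?thesis
    by simp
qed

text \<open>Expanding \<open>F\<close> to second order at \<open>x\<close> and evaluating at the
  zero \<open>z\<close>, then dividing by \<open>F' x\<close>, turns the new error into the Taylor
  remainder \<open>F'' t / (2 * F' x) * (x - z)\<^sup>2\<close>.\<close>

lemma newton_quadratic_step:
  fixes F F' F'' :: "real \<Rightarrow> real"
  assumes deriv: "\<And>x. x \<in> {a..b} \<Longrightarrow> (F has_real_derivative F' x) (at x)"
    "\<And>x. x \<in> {a..b} \<Longrightarrow> (F' has_real_derivative F'' x) (at x)"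
    and bound: "\<And>x. x \<in> {a..b} \<Longrightarrow> \<bar>F'' x\<bar> \<le> M"
    and x: "x \<in> {a..b}" "c \<le> F' x" "0 < c"
    and z: "z \<in> {a..b}" "F z = 0"
  shows "\<bar>x - F x / F' x - z\<bar> \<le> M / (2 * c) * \<bar>x - z\<bar>\<^sup>2"
proof (cases "z = x")
  case True
  with z show ?thesis
    by simp
next
  case False
  \<comment> \<open>Taylor's theorem takes the derivatives as a sequence indexed by order, and needs
    \<open>x\<close> and \<open>z\<close> distinct.\<close>
  define D where "D m = (if m = 0 then F else if m = 1 then F' else F'')" for m :: nat
  have D: "\<forall>m t. m < 2 \<and> a \<le> t \<and> t \<le> b \<longrightarrow> DERIV (D m) t :> D (Suc m) t"
    using deriv by (auto simp: D_def less_2_cases_iff)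
  obtain t where t: "if z < x then z < t \<and> t < x else x < t \<and> t < z"
    "F z = (\<Sum>m<2. (D m x / fact m) * (z - x) ^ m) + (D 2 t / fact 2) * (z - x) ^ 2"
    using Taylor[of 2 D F a b x z] D x z False by (auto simp: D_def)
  then have t_in: "t \<in> {a..b}"
    using x z by (auto split: if_splits)
  have "0 = F x + F' x * (z - x) + F'' t / 2 * (z - x)\<^sup>2"
    using t(2) z by (simp add: D_def numeral_2_eq_2)
  then have "F x + F' x * (z - x) = - (F'' t / 2 * (x - z)\<^sup>2)"
    by (simp add: power2_commute)
  moreover have "x - F x / F' x - z = - (F x + F' x * (z - x)) / F' x"
    using x by (simp add: field_simps)
  ultimately have "x - F x / F' x - z = F'' t / (2 * F' x) * (x - z)\<^sup>2"
    by simp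
  then have "\<bar>x - F x / F' x - z\<bar> = \<bar>F'' t\<bar> / (2 * F' x) * \<bar>x - z\<bar>\<^sup>2"
    using x by (simp add: abs_mult)
  also have "\<dots> \<le> M / (2 * c) * \<bar>x - z\<bar>\<^sup>2"
    using bound[OF t_in] x by (intro mult_right_mono frac_le) auto
  finally show ?thesis .
qed

subsection \<open>The functions \<open>eta\<close> and \<open>h\<close>\<close>

text \<open>This is \<open>1 + (kappa \<alpha> * cot (x / 2))\<^sup>2\<close>, from the derivative
  of arctan, multiplied by the squared sine of x/2: a form free of cotangents.\<close>

definition eta_den :: "real \<Rightarrow> real \<Rightarrow> real" where
  "eta_den \<alpha> x = (sin (x / 2))\<^sup>2 + (kappa \<alpha>)\<^sup>2 * (cos (x / 2))\<^sup>2"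

lemma kappa_pos: "0 < \<alpha> \<Longrightarrow> \<alpha> < 1 \<Longrightarrow> 0 < kappa \<alpha>"
  by (simp add: kappa_def)

lemma eta_den_alt: "eta_den \<alpha> x = (kappa \<alpha>)\<^sup>2 + (1 - (kappa \<alpha>)\<^sup>2) * (sin (x / 2))\<^sup>2"
  by (simp add: eta_den_def cos_squared_eq algebra_simps)

text \<open>\<open>eta_den\<close> is a convex combination of 1 and
  \<open>(kappa \<alpha>)\<^sup>2\<close>, with the squared sine and cosine of x/2 as
  weights.\<close>

lemma eta_den_ge_min: "min 1 ((kappa \<alpha>)\<^sup>2) \<le> eta_den \<alpha> x"
proof -
  have "min 1 ((kappa \<alpha>)\<^sup>2) = min 1 ((kappa \<alpha>)\<^sup>2) * (sin (x / 2))\<^sup>2 + min 1 ((kappa \<alpha>)\<^sup>2) * (cos (x / 2))\<^sup>2"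
    by (simp flip: distrib_left)
  also have "\<dots> \<le> 1 * (sin (x / 2))\<^sup>2 + (kappa \<alpha>)\<^sup>2 * (cos (x / 2))\<^sup>2"
    by (intro add_mono mult_right_mono) auto
  finally show ?thesis
    by (simp add: eta_den_def)
qed

lemma eta_den_pos:
  assumes "0 < \<alpha>" "\<alpha> < 1"
  shows "0 < eta_den \<alpha> x"
  using eta_den_ge_min[of \<alpha> x] kappa_pos[OF assms]
  by (smt (verit) zero_less_power)

lemma has_derivative_eta:
  assumes "0 < \<alpha>" "\<alpha> < 1" "0 < x" "x \<le> pi"
  shows "(eta \<alpha> has_real_derivative - kappa \<alpha> / eta_den \<alpha> x) (at x)"
proof -
  have s: "sin (x / 2) > 0"
    using assms by (intro sin_gt_zero) auto
  have "((\<lambda>x. cot (x / 2)) has_real_derivative - inverse ((sin (x / 2))\<^sup>2) * (1 / 2)) (at x)"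
    by (rule DERIV_chain2[OF DERIV_cot]) (use s in \<open>auto intro!: derivative_eq_intros\<close>)
  then have "(eta \<alpha> has_real_derivative
      2 * (inverse (1 + (kappa \<alpha> * cot (x / 2))\<^sup>2) *
        (kappa \<alpha> * (- inverse ((sin (x / 2))\<^sup>2) * (1 / 2))))) (at x)"
    unfolding eta_def by (intro DERIV_cmult DERIV_chain2[OF DERIV_arctan])
  also have "2 * (inverse (1 + (kappa \<alpha> * cot (x / 2))\<^sup>2) *
      (kappa \<alpha> * (- inverse ((sin (x / 2))\<^sup>2) * (1 / 2)))) = - kappa \<alpha> / eta_den \<alpha> x"
  proof -
    have "eta_den \<alpha> x = (1 + (kappa \<alpha> * cot (x / 2))\<^sup>2) * (sin (x / 2))\<^sup>2"
      using s by (simp add: eta_den_def cot_def field_simps)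
    moreover have "2 * (inverse u * (v * (- inverse w * (1 / 2)))) = - v / (u * w)" for u v w :: real
      by (simp add: inverse_eq_divide)
    ultimately show ?thesis
      by (simp only:)
  qed
  finally show ?thesis .
qed

lemma has_derivative_inverse_eta_den:
  assumes "0 < \<alpha>" "\<alpha> < 1"
  shows "((\<lambda>x. kappa \<alpha> / eta_den \<alpha> x) has_real_derivative
    kappa \<alpha> * ((kappa \<alpha>)\<^sup>2 - 1) * sin (x / 2) * cos (x / 2) / (eta_den \<alpha> x)\<^sup>2) (at x)"
proof -
  have "(eta_den \<alpha> has_real_derivative (1 - (kappa \<alpha>)\<^sup>2) * (sin (x / 2) * cos (x / 2))) (at x)"
    unfolding eta_den_def[abs_def]
    by (auto intro!: derivative_eq_intros simp: field_simps power2_eq_square)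
  then show ?thesis
    using eta_den_pos[OF assms, of x]
    by (auto intro!: derivative_eq_intros simp: field_simps power2_eq_square)
qed

text \<open>One factor of the squared denominator is absorbed by 2 k s c \<le> D, which comes from
  (s - k c)^2 \<ge> 0. The other is at least min(1, k^2), whose reciprocal is
  \<open>K1 \<alpha> / k\<close>. Together they give exactly \<open>K2 \<alpha>\<close>.\<close>

lemma inverse_eta_den_deriv_bound:
  assumes "0 < \<alpha>" "\<alpha> < 1"
  shows "\<bar>kappa \<alpha> * ((kappa \<alpha>)\<^sup>2 - 1) * sin (x / 2) * cos (x / 2) / (eta_den \<alpha> x)\<^sup>2\<bar> \<le> K2 \<alpha>"
proof -
  define k D s c where "k = kappa \<alpha>" and "D = eta_den \<alpha> x" and "s = \<bar>sin (x / 2)\<bar>" and "c = \<bar>cos (x / 2)\<bar>"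
  have k: "k > 0" and D: "D > 0"
    using kappa_pos eta_den_pos assms by (simp_all add: k_def D_def)
  have "D - 2 * k * s * c = (s - k * c)\<^sup>2"
    by (simp add: D_def eta_den_def s_def c_def k_def power2_diff power_mult_distrib)
  then have am_gm: "2 * k * s * c \<le> D"
    by (metis diff_ge_0_iff_ge zero_le_power2)
  have K1: "K1 \<alpha> / k = 1 / min 1 (k\<^sup>2)"
  proof (cases "k \<ge> 1")
    case True
    then have "1 / k \<le> k" "1 \<le> k\<^sup>2"
      using order_trans[of "1 / k" 1 k] by simp_all
    then show ?thesis
      using k by (simp add: K1_def k_def[symmetric])
  next
    case False
    then have "k \<le> 1 / k" "k\<^sup>2 \<le> 1"
      using order_trans[of k 1 "1 / k"] k by (simp_all add: power_le_one)
    then show ?thesis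
      by (simp add: K1_def k_def[symmetric] max_def min_def power2_eq_square)
  qed
  have "\<bar>kappa \<alpha> * ((kappa \<alpha>)\<^sup>2 - 1) * sin (x / 2) * cos (x / 2) / (eta_den \<alpha> x)\<^sup>2\<bar> =
      \<bar>k\<^sup>2 - 1\<bar> * (k * s * c) / D\<^sup>2"
    using k D by (simp add: abs_mult s_def c_def k_def[symmetric] D_def[symmetric])
  also have "\<dots> \<le> \<bar>k\<^sup>2 - 1\<bar> * (D / 2) / D\<^sup>2"
    using am_gm by (intro divide_right_mono mult_left_mono) auto
  also have "\<dots> = \<bar>k\<^sup>2 - 1\<bar> / 2 * (1 / D)"
    using D by (simp add: power2_eq_square)
  also have "\<dots> \<le> \<bar>k\<^sup>2 - 1\<bar> / 2 * (1 / min 1 (k\<^sup>2))"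
    using eta_den_ge_min[of \<alpha> x] k by (intro mult_left_mono frac_le) (auto simp: D_def k_def)
  also have "\<dots> = K2 \<alpha>"
    unfolding K1[symmetric] by (simp add: K2_def k_def)
  finally show ?thesis .
qed

text \<open>In \<open>eta_den_alt\<close> only the squared sine of x/2 varies, and it increases on
  [0, pi], so the sign of \<open>1 - (kappa \<alpha>)\<^sup>2\<close> decides the direction. This
  supplies the monotone derivative for \<open>newton_tendsto\<close>.\<close>

lemma inverse_eta_den_monotone:
  assumes "0 < \<alpha>" "\<alpha> < 1"
  shows "mono_on {0..pi} (\<lambda>x. kappa \<alpha> / eta_den \<alpha> x) \<or> antimono_on {0..pi} (\<lambda>x. kappa \<alpha> / eta_den \<alpha> x)"
proof -
  have k: "kappa \<alpha> > 0"
    using kappa_pos assms by simp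
  have s: "(sin (x / 2))\<^sup>2 \<le> (sin (y / 2))\<^sup>2" if "0 \<le> x" "x \<le> y" "y \<le> pi" for x y
    using that by (intro power_mono sin_monotone_2pi_le sin_ge_zero) auto
  show ?thesis
  proof (cases "kappa \<alpha> \<ge> 1")
    case True
    then have "1 - (kappa \<alpha>)\<^sup>2 \<le> 0"
      by simp
    then have "eta_den \<alpha> y \<le> eta_den \<alpha> x" if "0 \<le> x" "x \<le> y" "y \<le> pi" for x y
      unfolding eta_den_alt using s[OF that] by (intro add_left_mono mult_left_mono_neg)
    then have "mono_on {0..pi} (\<lambda>x. kappa \<alpha> / eta_den \<alpha> x)"
      using k eta_den_pos[OF assms] by (intro mono_onI divide_left_mono mult_pos_pos) auto
    then show ?thesis ..
  next
    case False
    then have "1 - (kappa \<alpha>)\<^sup>2 \<ge> 0"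
      using k by (simp add: power_le_one)
    then have "eta_den \<alpha> x \<le> eta_den \<alpha> y" if "0 \<le> x" "x \<le> y" "y \<le> pi" for x y
      unfolding eta_den_alt using s[OF that] by (intro add_left_mono mult_left_mono)
    then have "antimono_on {0..pi} (\<lambda>x. kappa \<alpha> / eta_den \<alpha> x)"
      using k eta_den_pos[OF assms] by (intro monotone_onI divide_left_mono mult_pos_pos) auto
    then show ?thesis ..
  qed
qed

text \<open>On (0, pi] the value cot(x/2) is nonnegative and vanishes only at pi, hence the separate
  condition for strict positivity.\<close>

lemma eta_bounds:
  assumes "0 < \<alpha>" "\<alpha> < 1" "0 < x" "x \<le> pi"
  shows "0 \<le> eta \<alpha> x" "eta \<alpha> x < pi" "x < pi \<Longrightarrow> 0 < eta \<alpha> x"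
proof -
  have k: "kappa \<alpha> > 0"
    using kappa_pos assms by simp
  have s: "sin (x / 2) > 0" and c: "cos (x / 2) \<ge> 0"
    using assms by (auto intro!: sin_gt_zero cos_ge_zero)
  show "0 \<le> eta \<alpha> x"
    using k s c by (simp add: eta_def cot_def)
  show "eta \<alpha> x < pi"
    using arctan_ubound[of "kappa \<alpha> * cot (x / 2)"] by (simp add: eta_def)
  show "0 < eta \<alpha> x" if "x < pi"
  proof -
    have "cos (x / 2) > 0"
      using assms that by (intro cos_gt_zero_pi) auto
    then show ?thesis
      using k s by (simp add: eta_def cot_def)
  qed
qed

section \<open>The Newton map and the zero of \<open>h\<close> on \<open>Ivl n j\<close>\<close>

lemma Ivl_subset:
  assumes "even j" "1 \<le> j" "j \<le> n"
  shows "Ivl n j \<subseteq> {0<..pi}"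
proof
  fix x assume x: "x \<in> Ivl n j"
  \<comment> \<open>An even \<open>j\<close> with \<open>1 \<le> j\<close> is at least 2, so the
    left endpoint is positive.\<close>
  have j: "real j - 1 > 0" "real j \<le> real n" "real n > 0"
    using assms by (auto elim!: evenE)
  then have "(real j - 1) * pi / real n > 0" "real j * pi / real n \<le> pi"
    by (simp_all add: divide_le_eq)
  then show "x \<in> {0<..pi}"
    using x by (auto simp: Ivl_def)
qed

lemma has_derivative_h:
  assumes "0 < \<alpha>" "\<alpha> < 1" "0 < x" "x \<le> pi"
  shows "(h \<alpha> n j has_real_derivative real n + kappa \<alpha> / eta_den \<alpha> x) (at x)"
  unfolding h_def
  by (rule derivative_eq_intros has_derivative_eta[OF assms] refl | simp)+

text \<open>Derivatives within a nondegenerate closed interval are unique, so \<open>h'\<close>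
  agrees with the two-sided derivative, which the formula for \<open>h\<close> has even at the
  endpoints.\<close>

lemma h'_eq:
  assumes "0 < \<alpha>" "\<alpha> < 1" "even j" "1 \<le> j" "j \<le> n" "x \<in> Ivl n j"
  shows "h' \<alpha> n j x = real n + kappa \<alpha> / eta_den \<alpha> x"
  unfolding h'_def Ivl_def
proof (rule vector_derivative_within_closed_interval)
  have "x \<in> {0<..pi}"
    using Ivl_subset[of j n] assms by blast
  then have "(h \<alpha> n j has_vector_derivative real n + kappa \<alpha> / eta_den \<alpha> x) (at x)"
    using has_derivative_h[of \<alpha> x] assms by (simp flip: has_real_derivative_iff_has_vector_derivative)
  then show "(h \<alpha> n j has_vector_derivative real n + kappa \<alpha> / eta_den \<alpha> x)
      (at x within {(real j - 1) * pi / real n .. real j * pi / real n})"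
    by (rule has_vector_derivative_at_within)
qed (use assms in \<open>auto simp: Ivl_def divide_strict_right_mono\<close>)

text \<open>The point x - h(x)/n = ((j - 1) pi + eta(x))/n lies in the interval because 0 \<le> eta
  < pi. As h' \<ge> n, the Newton step has the same direction and is no longer, so it ends between
  \<open>x\<close> and that point.\<close>

lemma newton_h_in_Ivl:
  assumes "0 < \<alpha>" "\<alpha> < 1" "even j" "1 \<le> j" "j \<le> n" "x \<in> Ivl n j"
  shows "x - h \<alpha> n j x / h' \<alpha> n j x \<in> Ivl n j"
proof -
  have x: "0 < x" "x \<le> pi"
    using Ivl_subset[of j n] assms by auto
  define d where "d = h' \<alpha> n j x"
  have n: "real n > 0"
    using assms by simp
  have d: "real n \<le> d"
    using eta_den_pos[of \<alpha> x] kappa_pos[of \<alpha>] assms by (simp add: d_def h'_eq)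
  have quotient: "min 0 (u / real n) \<le> u / d \<and> u / d \<le> max 0 (u / real n)" for u
  proof (cases "u \<ge> 0")
    case True
    then show ?thesis
      using divide_left_mono[OF d, of u] n d by auto
  next
    case False
    then show ?thesis
      using divide_left_mono_neg[OF d, of u] n d by (auto simp: divide_le_0_iff)
  qed
  have "h \<alpha> n j x \<le> real n * x - (real j - 1) * pi" "real n * x - real j * pi \<le> h \<alpha> n j x"
    using eta_bounds[OF assms(1,2) x] by (simp_all add: h_def algebra_simps)
  then have "h \<alpha> n j x / real n \<le> x - (real j - 1) * pi / real n"
    "x - real j * pi / real n \<le> h \<alpha> n j x / real n"
    using divide_right_mono[of "h \<alpha> n j x" "real n * x - (real j - 1) * pi" "real n"]
      divide_right_mono[of "real n * x - real j * pi" "h \<alpha> n j x" "real n"] n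
    by (simp_all add: diff_divide_distrib)
  then show ?thesis
    using quotient[of "h \<alpha> n j x"] assms(6) unfolding Ivl_def d_def[symmetric] by auto
qed

text \<open>At the left endpoint \<open>h\<close> equals -eta < 0, at the right endpoint pi - eta >
  0, so the intermediate value theorem applies.\<close>

lemma h_zero_exists:
  assumes "0 < \<alpha>" "\<alpha> < 1" "even j" "1 \<le> j" "j \<le> n"
  shows "\<exists>x. (real j - 1) * pi / real n < x \<and> x < real j * pi / real n \<and> h \<alpha> n j x = 0"
proof -
  define a b where "a = (real j - 1) * pi / real n" and "b = real j * pi / real n"
  have ab: "a < b"
    using assms by (simp add: a_def b_def divide_strict_right_mono)
  have Ivl: "{a..b} \<subseteq> {0<..pi}"
    using Ivl_subset assms by (simp add: Ivl_def a_def b_def)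
  then have a: "0 < a" and b: "b \<le> pi"
    using ab subsetD[OF Ivl, of a] subsetD[OF Ivl, of b] by auto
  have n: "real n > 0"
    using assms by simp
  have ha: "h \<alpha> n j a < 0"
    using eta_bounds(3)[OF assms(1,2), of a] ab a b n by (simp add: h_def) (simp add: a_def)
  have hb: "h \<alpha> n j b > 0"
    using eta_bounds(2)[OF assms(1,2), of b] ab a b n
    by (simp add: h_def) (simp add: b_def algebra_simps)
  have "isCont (h \<alpha> n j) x" if "x \<in> {a..b}" for x
    using has_derivative_h[of \<alpha> x n j] assms subsetD[OF Ivl that] by (auto intro: DERIV_isCont)
  then obtain x where "a \<le> x" "x \<le> b" "h \<alpha> n j x = 0"
    using IVT[of "h \<alpha> n j" a 0 b] ha hb ab by auto
  moreover from this have "x \<noteq> a" "x \<noteq> b"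
    using ha hb by auto
  ultimately show ?thesis
    unfolding a_def b_def by (intro exI[of _ x]) auto
qed

subsection \<open>Convergence to \<open>theta\<close>\<close>

text \<open>The two families of angles interlace, one in each [i pi/n, (i + 1) pi/n) with i < n, so
  \<open>eig_eqI\<close> identifies the sorted spectrum; its entry number \<open>j\<close> comes
  from a zero of \<open>h \<alpha> n j\<close>.\<close>

lemma theta_is_h_zero:
  assumes \<alpha>: "0 < \<alpha>" "\<alpha> < 1" and n: "n \<ge> 3" and j: "even j" "1 \<le> j" "j \<le> n"
  shows "theta \<alpha> n j \<in> Ivl n j" "h \<alpha> n j (theta \<alpha> n j) = 0"
proof -
  have "\<forall>k\<in>{k. even k \<and> 1 \<le> k \<and> k \<le> n}. \<exists>x. (real k - 1) * pi / real n < x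
      \<and> x < real k * pi / real n \<and> h \<alpha> n k x = 0"
    using h_zero_exists[OF \<alpha>] by blast
  from bchoice[OF this] obtain Z where Z: "(real k - 1) * pi / real n < Z k"
      "Z k < real k * pi / real n" "h \<alpha> n k (Z k) = 0"
    if "even k" "1 \<le> k" "k \<le> n" for k
    by blast
  \<comment> \<open>Counting starts at 0: \<open>t i\<close> gives eigenvalue number i + 1. Even
    \<open>i\<close> carry the symmetric angles, odd \<open>i\<close> the zeros of \<open>h\<close>
    with the even index \<open>Suc i\<close>.\<close>
  define t where "t i = (if even i then real i * pi / real n else Z (Suc i))" for i
  have t_ge: "real i * pi / real n \<le> t i" and t_less: "t i < (real i + 1) * pi / real n"
    if "i < n" for i
  proof -
    show "real i * pi / real n \<le> t i"
      using Z(1)[of "Suc i"] that by (auto simp: t_def)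
    show "t i < (real i + 1) * pi / real n"
      using Z(2)[of "Suc i"] that n by (auto simp: t_def divide_strict_right_mono add.commute)
  qed
  have t_nonneg: "0 \<le> t i" if "i < n" for i
    using order_trans[OF _ t_ge[OF that], of 0] by simp
  have t_less_pi: "t i < pi" if "i < n" for i
  proof -
    have "(real i + 1) * pi / real n \<le> pi"
      using that n by (simp add: divide_le_eq mult.commute[of _ pi])
    then show ?thesis
      using t_less[OF that] by linarith
  qed
  have "eig \<alpha> n j = g (t (j - 1))"
  proof (rule eig_eqI[OF _ _ j(2,3)])
    fix i assume i: "i < n"
    show "poly (char_poly (L_mat \<alpha> n)) (g (t i)) = 0"
    proof (cases "even i")
      case True
      then obtain m where "i = 2 * m"
        by blast
      then have "sin (real n * t i / 2) = 0"
        using n by (simp add: t_def)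
      then show ?thesis
        using char_poly_root_symmetric[OF n _ t_nonneg t_less_pi] i by blast
    next
      case False
      then have "0 < real i * pi / real n"
        using n odd_pos[of i] by simp
      then have "0 < t i"
        using t_ge[OF i] by linarith
      moreover have "h \<alpha> n (Suc i) (t i) = 0"
        using Z(3)[of "Suc i"] False i by (simp add: t_def)
      ultimately show ?thesis
        using char_poly_root_h_zero[OF \<alpha> n, of "Suc i" "t i"] False t_less_pi[OF i] by simp
    qed
  next
    fix i assume i: "Suc i < n"
    have "t i < t (Suc i)"
      using t_less[of i] t_ge[of "Suc i"] i by (simp add: add.commute)
    then show "g (t i) < g (t (Suc i))"
      using g_strict_mono[of "t i" "t (Suc i)"] t_nonneg[of i] t_less_pi[OF i] i by simp
  qed
  also have "t (j - 1) = Z j"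
    using j by (simp add: t_def)
  finally have eig: "eig \<alpha> n j = g (Z j)" .
  have Zj: "Z j \<in> Ivl n j"
    using Z[OF j] by (simp add: Ivl_def)
  then have "Z j \<in> {0..pi}"
    using Ivl_subset[OF j] by auto
  \<comment> \<open>Strict monotonicity of \<open>g\<close> on [0, pi] makes the definite
    description unique.\<close>
  then have "theta \<alpha> n j = Z j"
    unfolding theta_def eig
    by (intro the_equality) (use g_strict_mono in \<open>auto, smt (verit)\<close>)
  then show "theta \<alpha> n j \<in> Ivl n j" "h \<alpha> n j (theta \<alpha> n j) = 0"
    using Z(3)[OF j] Zj by simp_all
qed

text \<open>Division and \<open>vector_derivative\<close> are total functions, so the first conjunct
  records that the recursion is meaningful: the iterates stay in the domain of \<open>h\<close>,
  where the derivative exists and is nonzero.\<close>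

theorem theorem3:
  fixes \<alpha> :: real and n j :: nat and y :: "nat \<Rightarrow> real"
  assumes "0 < \<alpha>" and "\<alpha> < 1"
    and "n \<ge> 3"
    and "even j" and "1 \<le> j" and "j \<le> n"
    and "y 0 \<in> Ivl n j"
    and "\<And>m. m \<ge> 1 \<Longrightarrow> y m = y (m - 1) - h \<alpha> n j (y (m - 1)) / h' \<alpha> n j (y (m - 1))"
  shows "(\<forall>m. y m \<in> Ivl n j
            \<and> h \<alpha> n j differentiable (at (y m) within Ivl n j)
            \<and> h' \<alpha> n j (y m) \<noteq> 0)
       \<and> y \<longlonglongrightarrow> theta \<alpha> n j
       \<and> (real n > sqrt (pi * K2 \<alpha> / 2) \<longrightarrow>
            (\<forall>m. \<bar>y m - theta \<alpha> n j\<bar>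
               \<le> pi / real n * (pi * K2 \<alpha> / (2 * (real n)\<^sup>2)) ^ (2 ^ m - 1)))"
proof -
  note \<alpha> = assms(1,2) and j = assms(4-6)
  define a b where "a = (real j - 1) * pi / real n" and "b = real j * pi / real n"
  have Ivl: "Ivl n j = {a..b}"
    by (simp add: Ivl_def a_def b_def)
  have ba: "b - a = pi / real n"
    by (simp add: a_def b_def left_diff_distrib diff_divide_distrib)
  have n: "real n > 0"
    using assms(3) by simp
  define F' where "F' x = real n + kappa \<alpha> / eta_den \<alpha> x" for x
  define z where "z = theta \<alpha> n j"
  have z: "z \<in> {a..b}" "h \<alpha> n j z = 0"
    using theta_is_h_zero[OF \<alpha> assms(3) j] by (simp_all add: z_def Ivl)
  have k: "kappa \<alpha> > 0"
    using kappa_pos[OF \<alpha>] .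
  have pos: "0 < x \<and> x \<le> pi" if "x \<in> {a..b}" for x
    using Ivl_subset[OF j] that by (auto simp: Ivl)
  have deriv: "(h \<alpha> n j has_real_derivative F' x) (at x)" if "x \<in> {a..b}" for x
    using has_derivative_h[OF \<alpha>] pos[OF that] by (simp add: F'_def)
  have h': "h' \<alpha> n j x = F' x" if "x \<in> {a..b}" for x
    using h'_eq[OF \<alpha> j, of x] that by (simp add: Ivl F'_def)
  have F'_ge: "real n \<le> F' x" for x
    using k eta_den_pos[OF \<alpha>, of x] by (simp add: F'_def)
  \<comment> \<open>A bound uniform in \<open>x\<close>, which serves as the constant
    \<open>C\<close> of \<open>newton_tendsto\<close>.\<close>
  have F'_le: "F' x \<le> real n + kappa \<alpha> / min 1 ((kappa \<alpha>)\<^sup>2)" for x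
    unfolding F'_def using k eta_den_ge_min by (intro add_left_mono frac_le) auto
  have mono: "mono_on {a..b} F' \<or> antimono_on {a..b} F'"
  proof -
    have "{a..b} \<subseteq> {0..pi}"
      using pos by fastforce
    then show ?thesis
      using inverse_eta_den_monotone[OF \<alpha>] unfolding F'_def monotone_on_def
      by (meson add_left_mono subset_iff)
  qed
  have y_Suc: "y (Suc m) = y m - h \<alpha> n j (y m) / h' \<alpha> n j (y m)" for m
    using assms(8)[of "Suc m"] by simp
  have y: "y m \<in> {a..b}" for m
  proof (induction m)
    case 0
    then show ?case
      using assms(7) by (simp add: Ivl)
  next
    case (Suc m)
    then show ?case
      using newton_h_in_Ivl[OF \<alpha> j, of "y m"] unfolding y_Suc Ivl by blast
  qed
  have step: "y (Suc m) = y m - h \<alpha> n j (y m) / F' (y m)" for m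
    using y_Suc h'[OF y] by simp
  have "h \<alpha> n j differentiable (at (y m) within Ivl n j)" for m
    using deriv[OF y[of m]] real_differentiable_def differentiable_at_withinI by blast
  moreover have "h' \<alpha> n j (y m) \<noteq> 0" for m
    using h'[OF y[of m]] F'_ge[of "y m"] n by simp
  moreover have "y \<longlonglongrightarrow> z"
    by (rule newton_tendsto[where F = "h \<alpha> n j" and F' = F' and y = y, OF deriv F'_ge F'_le n
          mono y step z])
  moreover have "\<bar>y m - z\<bar> \<le> pi / real n * (pi * K2 \<alpha> / (2 * (real n)\<^sup>2)) ^ (2 ^ m - 1)" for m
  proof (induction m)
    case 0
    have "\<bar>y 0 - z\<bar> \<le> b - a"
      using y[of 0] z by auto
    then show ?case
      by (simp add: ba)
  next
    case (Suc m)
    define q where "q = pi * K2 \<alpha> / (2 * (real n)\<^sup>2)"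
    \<comment> \<open>Squaring the bound doubles the exponent \<open>N\<close>, and K2/(2n) times
      (pi/n)^2 equals (pi/n) q, which adds one more factor \<open>q\<close>. The new exponent is 2N
      + 1 = 2^(m + 1) - 1.\<close>
    define N :: nat where "N = 2 ^ m - 1"
    have "2 ^ m = Suc N"
      by (simp add: N_def)
    then have N: "2 ^ Suc m - 1 = Suc (2 * N)"
      by simp
    have K2: "K2 \<alpha> \<ge> 0"
      using inverse_eta_den_deriv_bound[OF \<alpha>, of 0] by linarith
    have "((\<lambda>x. F' x) has_real_derivative
        kappa \<alpha> * ((kappa \<alpha>)\<^sup>2 - 1) * sin (x / 2) * cos (x / 2) / (eta_den \<alpha> x)\<^sup>2) (at x)" for x
      unfolding F'_def using DERIV_add[OF DERIV_const has_derivative_inverse_eta_den[OF \<alpha>]] by simp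
    then have "\<bar>y (Suc m) - z\<bar> \<le> K2 \<alpha> / (2 * real n) * \<bar>y m - z\<bar>\<^sup>2"
      unfolding step
      by (intro newton_quadratic_step[OF deriv _ inverse_eta_den_deriv_bound[OF \<alpha>] y F'_ge n z]) auto
    also have "\<dots> \<le> K2 \<alpha> / (2 * real n) * (pi / real n * q ^ N)\<^sup>2"
      using Suc K2 by (intro mult_left_mono power_mono) (auto simp: q_def N_def)
    also have "\<dots> = pi / real n * (q * (q ^ N)\<^sup>2)"
      by (simp add: q_def power2_eq_square mult_ac)
    also have "q * (q ^ N)\<^sup>2 = q ^ (2 ^ Suc m - 1)"
      unfolding N by (simp add: power_mult mult.commute flip: power_mult)
    finally show ?case
      by (simp add: q_def)
  qed
  ultimately show ?thesis
    using y unfolding Ivl z_def by blast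
qed

end
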